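(* Let $m_1,m_2,m_3>0$ and let $t\mapsto(z_1(t),z_2(t),z_3(t))\in\mathbb{C}^3$, $t\in\mathbb{R}$, be a periodic solution of the planar Newtonian three-body problem with masses $m_1,m_2,m_3$ and centre of mass at the origin. Suppose that the solution is $\theta$-rigid, i.e. there exists a non-zero vector $\theta=(\theta_1,\theta_2,\theta_3)\in\mathbb{R}^3$ such that $$\theta_1(\rho_3(t)-\rho_2(t))+\theta_2(\rho_1(t)-\rho_3(t))+\theta_3(\rho_2(t)-\rho_1(t))\ge 0\quad\text{for all }t\in\mathbb{R},$$ with strict inequality for at least one $t\in\mathbb{R}$, where $\rho_1=|z_3-z_2|^{-3}$, $\rho_2=|z_1-z_3|^{-3}$, $\rho_3=|z_2-z_1|^{-3}$. Then the solution admits a syzygy: there exists $t_0\in\mathbb{R}$ such that $z_1(t_0),z_2(t_0),z_3(t_0)$ lie on one straight line.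
   Context: The planar Newtonian three-body problem with masses $m_1,m_2,m_3>0$ is the system, for $z_k=x_k+iy_k\in\mathbb{C}$ and $z_{kl}=z_k-z_l$, $$\ddot z_1=m_2\frac{z_{21}}{|z_{21}|^3}-m_3\frac{z_{13}}{|z_{13}|^3},\quad \ddot z_2=m_3\frac{z_{32}}{|z_{32}|^3}-m_1\frac{z_{21}}{|z_{21}|^3},\quad \ddot z_3=m_1\frac{z_{13}}{|z_{13}|^3}-m_2\frac{z_{32}}{|z_{32}|^3}.$$ Standing assumption: $\sum_k m_k z_k=\sum_k m_k\dot z_k=0$ (centre of mass at the origin). A solution has pairwise distinct $z_1(t),z_2(t),z_3(t)$ at every time $t$ of its domain (no collisions). Periodic means that there is $\tau>0$ with $z_k(t+\tau)=z_k(t)$ for all $t\in\mathbb{R}$, $k=1,2,3$. *)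

theory Defs
  imports "HOL-Analysis.Analysis"
begin

text \<open>
  The positions \<open>z1, z2, z3\<close> are functions of time into the complex plane; solutions are
  collision-free and defined for all real times. The acceleration is expressed through velocities
  \<open>v1, v2, v3\<close>, so both derivatives are required to exist.
\<close>

definition three_body_solution ::
  "real \<Rightarrow> real \<Rightarrow> real \<Rightarrow> (real \<Rightarrow> complex) \<Rightarrow> (real \<Rightarrow> complex) \<Rightarrow> (real \<Rightarrow> complex) \<Rightarrow> bool"
where
  "three_body_solution m1 m2 m3 z1 z2 z3 \<longleftrightarrow>
    (\<forall>t. z1 t \<noteq> z2 t \<and> z2 t \<noteq> z3 t \<and> z3 t \<noteq> z1 t) \<and>
    (\<exists>v1 v2 v3. \<forall>t.
      (z1 has_vector_derivative v1 t) (at t) \<and>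
      (z2 has_vector_derivative v2 t) (at t) \<and>
      (z3 has_vector_derivative v3 t) (at t) \<and>
      (v1 has_vector_derivative
         ((m2 / cmod (z2 t - z1 t) ^ 3) *\<^sub>R (z2 t - z1 t)
          - (m3 / cmod (z1 t - z3 t) ^ 3) *\<^sub>R (z1 t - z3 t))) (at t) \<and>
      (v2 has_vector_derivative
         ((m3 / cmod (z3 t - z2 t) ^ 3) *\<^sub>R (z3 t - z2 t)
          - (m1 / cmod (z2 t - z1 t) ^ 3) *\<^sub>R (z2 t - z1 t))) (at t) \<and>
      (v3 has_vector_derivative
         ((m1 / cmod (z1 t - z3 t) ^ 3) *\<^sub>R (z1 t - z3 t)
          - (m2 / cmod (z3 t - z2 t) ^ 3) *\<^sub>R (z3 t - z2 t))) (at t))"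

definition centre_of_mass_at_origin ::
  "real \<Rightarrow> real \<Rightarrow> real \<Rightarrow> (real \<Rightarrow> complex) \<Rightarrow> (real \<Rightarrow> complex) \<Rightarrow> (real \<Rightarrow> complex) \<Rightarrow> bool"
where
  "centre_of_mass_at_origin m1 m2 m3 z1 z2 z3 \<longleftrightarrow>
    (\<forall>t. m1 *\<^sub>R z1 t + m2 *\<^sub>R z2 t + m3 *\<^sub>R z3 t = 0 \<and>
         m1 *\<^sub>R vector_derivative z1 (at t) + m2 *\<^sub>R vector_derivative z2 (at t)
           + m3 *\<^sub>R vector_derivative z3 (at t) = 0)"

definition periodic_motion ::
  "(real \<Rightarrow> complex) \<Rightarrow> (real \<Rightarrow> complex) \<Rightarrow> (real \<Rightarrow> complex) \<Rightarrow> bool"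
where
  "periodic_motion z1 z2 z3 \<longleftrightarrow>
    (\<exists>\<tau>>0. \<forall>t. z1 (t + \<tau>) = z1 t \<and> z2 (t + \<tau>) = z2 t \<and> z3 (t + \<tau>) = z3 t)"

definition rigid_wrt ::
  "real \<times> real \<times> real \<Rightarrow> (real \<Rightarrow> complex) \<Rightarrow> (real \<Rightarrow> complex) \<Rightarrow> (real \<Rightarrow> complex) \<Rightarrow> bool"
where
  "rigid_wrt = (\<lambda>(\<theta>1, \<theta>2, \<theta>3) z1 z2 z3.
    let \<rho>1 = (\<lambda>t. 1 / cmod (z3 t - z2 t) ^ 3);
        \<rho>2 = (\<lambda>t. 1 / cmod (z1 t - z3 t) ^ 3);
        \<rho>3 = (\<lambda>t. 1 / cmod (z2 t - z1 t) ^ 3);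
        F = (\<lambda>t. \<theta>1 * (\<rho>3 t - \<rho>2 t) + \<theta>2 * (\<rho>1 t - \<rho>3 t) + \<theta>3 * (\<rho>2 t - \<rho>1 t))
    in (\<forall>t. F t \<ge> 0) \<and> (\<exists>t. F t > 0))"

end

theory Submission
  imports Defs
begin

text \<open>
  Write \<open>s\<^sub>1 = z\<^sub>3 - z\<^sub>2\<close>, \<open>s\<^sub>2 = z\<^sub>1 - z\<^sub>3\<close>, \<open>s\<^sub>3 = z\<^sub>2 - z\<^sub>1\<close> for the edges of the triangle and \<open>D\<close> for
  twice its signed area. Newton's equations take the form
  \<open>s\<^sub>k'' = - (m\<^sub>1 + m\<^sub>2 + m\<^sub>3) \<rho>\<^sub>k s\<^sub>k + m\<^sub>k (\<rho>\<^sub>1 s\<^sub>1 + \<rho>\<^sub>2 s\<^sub>2 + \<rho>\<^sub>3 s\<^sub>3)\<close>.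
  In the time derivative \<open>s\<^sub>k \<times> s\<^sub>k''\<close> of the angular momentum \<open>s\<^sub>k \<times> s\<^sub>k'\<close> of an edge, the central
  term drops out, and the cross products of two different edges are all \<open>D\<close> or \<open>- D\<close>. Hence the
  derivative of \<open>s\<^sub>1 \<times> s\<^sub>1' / m\<^sub>1\<close> is \<open>(\<rho>\<^sub>2 - \<rho>\<^sub>3) D\<close>, and cyclically. Weighting by \<open>\<theta>\<close>,
  the function \<open>G = \<Sum>\<^sub>k \<theta>\<^sub>k (s\<^sub>k \<times> s\<^sub>k') / m\<^sub>k\<close> satisfies \<open>G' = - F D\<close>, where \<open>F\<close> is the expression that the
  rigidity hypothesis makes nonnegative.

  Without a syzygy, \<open>D\<close> has no zero and therefore a constant sign, so \<open>G\<close> is monotone. It is also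
  periodic, because the velocities inherit the period of the positions. A monotone periodic function is
  constant, so \<open>F D\<close> vanishes identically, contradicting \<open>F > 0\<close> at some time.
\<close>

definition cross :: "complex \<Rightarrow> complex \<Rightarrow> real" where
  "cross u v = Im (cnj u * v)"

lemma bounded_bilinear_cross: "bounded_bilinear cross"
proof -
  have "cross = (\<lambda>u. (\<bullet>) (\<i> * u))"
    by (intro ext) (simp add: cross_def inner_complex_def)
  then show ?thesis
    using bounded_bilinear.comp1[OF bounded_bilinear_inner bounded_linear_mult_right[of \<i>]]
    by simp
qed

lemma collinear_3_if_cross_zero:
  assumes "cross (b - a) (c - a) = 0"
  shows "collinear {a, b, c}"
proof -
  have "Im ((c - a) / (b - a)) = 0"
    using assms by (simp add: cross_def Im_complex_div_eq_0 mult.commute)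
  then have "collinear {0, b - a, c - a}"
    by (simp add: collinear_iff_Reals complex_is_Real_iff)
  then have "collinear {b, a, c}"
    by (simp add: collinear_3)
  then show ?thesis by (simp add: insert_commute)
qed

lemma angular_momentum_has_derivative:
  assumes "(u has_vector_derivative v t) (at t)" "(v has_vector_derivative a) (at t)"
  shows "((\<lambda>t. cross (u t) (v t)) has_real_derivative cross (u t) a) (at t)"
proof -
  have "((\<lambda>t. cross (u t) (v t)) has_vector_derivative cross (u t) a + cross (v t) (v t)) (at t)"
    using bounded_bilinear.has_vector_derivative[OF bounded_bilinear_cross assms] .
  moreover have "cross (v t) (v t) = 0" by (simp add: cross_def)
  ultimately show ?thesis by (simp add: has_real_derivative_iff_has_vector_derivative)
qed

text \<open>
  The torque on the edge from \<open>b\<close> to \<open>c\<close>, for arbitrary strengths \<open>p\<close>, \<open>q\<close>, \<open>r\<close> of the attractions along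
  the edges opposite \<open>a\<close>, \<open>b\<close>, \<open>c\<close>. The attraction between \<open>b\<close> and \<open>c\<close> acts along the edge itself,
  so only the pulls of the third body contribute.
\<close>

lemma cross_edge_acceleration:
  "cross (c - b)
     (((ma * q) *\<^sub>R (a - c) - (mb * p) *\<^sub>R (c - b)) - ((mc * p) *\<^sub>R (c - b) - (ma * r) *\<^sub>R (b - a)))
   = ma * (q - r) * cross (b - a) (c - a)"
  by (simp add: cross_def algebra_simps)

lemma continuous_nonzero_constant_sign:
  fixes f :: "real \<Rightarrow> real"
  assumes "continuous_on UNIV f" and "\<And>t. f t \<noteq> 0"
  obtains \<sigma> :: real where "\<And>t. \<sigma> * f t > 0"
proof -
  have conn: "is_interval (range f)"
    using connected_continuous_image[OF assms(1)] by (simp add: is_interval_connected_1)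
  have same_sign: "f s > 0 \<longleftrightarrow> f t > 0" for s t
    using mem_is_interval_1_I[OF conn, of "f s" "f t" 0]
      mem_is_interval_1_I[OF conn, of "f t" "f s" 0] assms(2)
    by (smt (verit) rangeE rangeI)
  have "sgn (f 0) * f t > 0" for t
    using same_sign[of t 0] assms(2)[of t] assms(2)[of 0] by (auto simp: sgn_real_def)
  then show thesis using that by blast
qed

lemma periodic_deriv_nonneg_imp_deriv_zero:
  fixes f f' :: "real \<Rightarrow> real"
  assumes deriv: "\<And>t. (f has_real_derivative f' t) (at t)"
    and nonneg: "\<And>t. f' t \<ge> 0"
    and period: "\<tau> > 0" "\<And>t. f (t + \<tau>) = f t"
  shows "f' t = 0"
proof -
  have mono: "f x \<le> f y" if "x \<le> y" for x y
    using DERIV_nonneg_imp_nondecreasing[OF that] deriv nonneg by blast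
  \<comment> \<open>The derivative at \<open>t\<close> is two-sided, so constancy is needed on both sides of \<open>t\<close>.\<close>
  have const: "f x = f t" if "\<bar>t - x\<bar> < \<tau>" for x
    using mono[of "t - \<tau>" x] mono[of x "t + \<tau>"] mono[of "t - \<tau>" t] mono[of t "t + \<tau>"]
      period(2)[of "t - \<tau>"] period(2)[of t] that by (auto simp: abs_if split: if_splits)
  show ?thesis
    using DERIV_local_const[OF deriv period(1)] const by metis
qed

lemma periodic_vector_derivative:
  assumes deriv: "\<And>t. (z has_vector_derivative v t) (at t)"
    and period: "\<And>t. z (t + \<tau>) = z t"
  shows "v (t + \<tau>) = v t"
proof -
  have "((\<lambda>x. z (x + \<tau>)) has_vector_derivative v (t + \<tau>)) (at t)"
    using vector_diff_chain_at[of "\<lambda>x. x + \<tau>" 1 t z "v (t + \<tau>)"] deriv[of "t + \<tau>"]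
    by (simp add: o_def has_vector_derivative_add_const)
  then have "(z has_vector_derivative v (t + \<tau>)) (at t)"
    using period by simp
  then show ?thesis using deriv vector_derivative_unique_at by blast
qed

text \<open>
  The monotone quantity. It weights the angular momenta of the edges by \<open>\<theta>\<^sub>k / m\<^sub>k\<close>, which cancels
  the masses and makes its derivative minus twice the signed area times exactly the combination of
  the \<open>\<rho>\<^sub>k\<close> in the rigidity condition.
\<close>

lemma weighted_edge_momentum_has_derivative:
  fixes z1 z2 z3 v1 v2 v3 :: "real \<Rightarrow> complex"
  assumes m: "m1 \<noteq> 0" "m2 \<noteq> 0" "m3 \<noteq> 0"
    and z: "(z1 has_vector_derivative v1 t) (at t)" "(z2 has_vector_derivative v2 t) (at t)"
           "(z3 has_vector_derivative v3 t) (at t)"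
    and v: "(v1 has_vector_derivative ((m2 * r) *\<^sub>R (z2 t - z1 t) - (m3 * q) *\<^sub>R (z1 t - z3 t))) (at t)"
           "(v2 has_vector_derivative ((m3 * p) *\<^sub>R (z3 t - z2 t) - (m1 * r) *\<^sub>R (z2 t - z1 t))) (at t)"
           "(v3 has_vector_derivative ((m1 * q) *\<^sub>R (z1 t - z3 t) - (m2 * p) *\<^sub>R (z3 t - z2 t))) (at t)"
  shows "((\<lambda>t. \<theta>1 / m1 * cross (z3 t - z2 t) (v3 t - v2 t)
             + \<theta>2 / m2 * cross (z1 t - z3 t) (v1 t - v3 t)
             + \<theta>3 / m3 * cross (z2 t - z1 t) (v2 t - v1 t))
          has_real_derivative
          - ((\<theta>1 * (r - q) + \<theta>2 * (p - r) + \<theta>3 * (q - p)) * cross (z2 t - z1 t) (z3 t - z1 t))) (at t)"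
proof -
  let ?D = "cross (z2 t - z1 t) (z3 t - z1 t)"
  have area: "cross (z3 t - z2 t) (z1 t - z2 t) = ?D" "cross (z1 t - z3 t) (z2 t - z3 t) = ?D"
    by (simp_all add: cross_def algebra_simps)
  have e1: "((\<lambda>t. cross (z3 t - z2 t) (v3 t - v2 t)) has_real_derivative m1 * (q - r) * ?D) (at t)"
    using angular_momentum_has_derivative[where v = "\<lambda>t. v3 t - v2 t",
        OF has_vector_derivative_diff[OF z(3) z(2)] has_vector_derivative_diff[OF v(3) v(2)]]
    by (simp only: cross_edge_acceleration)
  have e2: "((\<lambda>t. cross (z1 t - z3 t) (v1 t - v3 t)) has_real_derivative m2 * (r - p) * ?D) (at t)"
    using angular_momentum_has_derivative[where v = "\<lambda>t. v1 t - v3 t",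
        OF has_vector_derivative_diff[OF z(1) z(3)] has_vector_derivative_diff[OF v(1) v(3)]]
    by (simp only: cross_edge_acceleration area)
  have e3: "((\<lambda>t. cross (z2 t - z1 t) (v2 t - v1 t)) has_real_derivative m3 * (p - q) * ?D) (at t)"
    using angular_momentum_has_derivative[where v = "\<lambda>t. v2 t - v1 t",
        OF has_vector_derivative_diff[OF z(2) z(1)] has_vector_derivative_diff[OF v(2) v(1)]]
    by (simp only: cross_edge_acceleration area)
  have "\<theta>1 / m1 * (m1 * (q - r) * ?D) + \<theta>2 / m2 * (m2 * (r - p) * ?D) + \<theta>3 / m3 * (m3 * (p - q) * ?D)
      = - ((\<theta>1 * (r - q) + \<theta>2 * (p - r) + \<theta>3 * (q - p)) * ?D)"
    using m by (simp add: algebra_simps)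
  with DERIV_add[OF DERIV_add[OF DERIV_cmult[OF e1, of "\<theta>1 / m1"] DERIV_cmult[OF e2, of "\<theta>2 / m2"]]
      DERIV_cmult[OF e3, of "\<theta>3 / m3"]]
  show ?thesis by simp
qed

theorem theorem3p1:
  fixes m1 m2 m3 :: real
    and z1 z2 z3 :: "real \<Rightarrow> complex"
  assumes "m1 > 0" "m2 > 0" "m3 > 0"
    and "three_body_solution m1 m2 m3 z1 z2 z3"
    and "centre_of_mass_at_origin m1 m2 m3 z1 z2 z3"
    and "periodic_motion z1 z2 z3"
    and "\<exists>\<theta>. \<theta> \<noteq> (0, 0, 0) \<and> rigid_wrt \<theta> z1 z2 z3"
  shows "\<exists>t0. collinear {z1 t0, z2 t0, z3 t0}"
proof (rule ccontr)
  assume no_syzygy: "\<nexists>t0. collinear {z1 t0, z2 t0, z3 t0}"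
  define p where "p = (\<lambda>t. 1 / cmod (z3 t - z2 t) ^ 3)"
  define q where "q = (\<lambda>t. 1 / cmod (z1 t - z3 t) ^ 3)"
  define r where "r = (\<lambda>t. 1 / cmod (z2 t - z1 t) ^ 3)"
  define D where "D = (\<lambda>t. cross (z2 t - z1 t) (z3 t - z1 t))"
  obtain v1 v2 v3 where
    z: "\<And>t. (z1 has_vector_derivative v1 t) (at t)" "\<And>t. (z2 has_vector_derivative v2 t) (at t)"
       "\<And>t. (z3 has_vector_derivative v3 t) (at t)" and
    v: "\<And>t. (v1 has_vector_derivative ((m2 * r t) *\<^sub>R (z2 t - z1 t) - (m3 * q t) *\<^sub>R (z1 t - z3 t))) (at t)"
       "\<And>t. (v2 has_vector_derivative ((m3 * p t) *\<^sub>R (z3 t - z2 t) - (m1 * r t) *\<^sub>R (z2 t - z1 t))) (at t)"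
       "\<And>t. (v3 has_vector_derivative ((m1 * q t) *\<^sub>R (z1 t - z3 t) - (m2 * p t) *\<^sub>R (z3 t - z2 t))) (at t)"
    using assms(4) unfolding three_body_solution_def p_def q_def r_def mult_1_right times_divide_eq_right
    by blast
  obtain \<tau> where \<tau>: "\<tau> > 0"
    and z_period: "\<And>t. z1 (t + \<tau>) = z1 t" "\<And>t. z2 (t + \<tau>) = z2 t" "\<And>t. z3 (t + \<tau>) = z3 t"
    using assms(6) unfolding periodic_motion_def by blast
  note v_period = z(1)[THEN periodic_vector_derivative, OF z_period(1)]
    z(2)[THEN periodic_vector_derivative, OF z_period(2)]
    z(3)[THEN periodic_vector_derivative, OF z_period(3)]
  obtain \<theta>1 \<theta>2 \<theta>3 where rigid: "rigid_wrt (\<theta>1, \<theta>2, \<theta>3) z1 z2 z3"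
    using assms(7) by (metis prod_cases3)
  define F where "F = (\<lambda>t. \<theta>1 * (r t - q t) + \<theta>2 * (p t - r t) + \<theta>3 * (q t - p t))"
  obtain t1 where F: "\<And>t. F t \<ge> 0" "F t1 > 0"
    using rigid unfolding rigid_wrt_def Let_def F_def p_def q_def r_def by auto

  have "continuous_on UNIV z" if "\<And>t. (z has_vector_derivative v t) (at t)"
    for z v :: "real \<Rightarrow> complex"
    using that has_vector_derivative_continuous continuous_at_imp_continuous_on by blast
  then have "continuous_on UNIV D"
    unfolding D_def using z
    by (intro bounded_bilinear.continuous_on[OF bounded_bilinear_cross] continuous_on_diff) blast+
  moreover have "D t \<noteq> 0" for t
    using no_syzygy collinear_3_if_cross_zero unfolding D_def by blast
  ultimately obtain \<sigma> where \<sigma>: "\<And>t. \<sigma> * D t > 0"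
    using continuous_nonzero_constant_sign by blast

  define G where "G = (\<lambda>t. \<theta>1 / m1 * cross (z3 t - z2 t) (v3 t - v2 t)
    + \<theta>2 / m2 * cross (z1 t - z3 t) (v1 t - v3 t)
    + \<theta>3 / m3 * cross (z2 t - z1 t) (v2 t - v1 t))"
  have G_deriv: "(G has_real_derivative - (F t * D t)) (at t)" for t
    unfolding G_def F_def D_def
    by (rule weighted_edge_momentum_has_derivative) (use assms(1-3) z v in auto)
  have "((\<lambda>t. - \<sigma> * G t) has_real_derivative F t * (\<sigma> * D t)) (at t)" for t
    using DERIV_cmult[OF G_deriv, of "- \<sigma>" t] by (simp add: mult_ac)
  moreover have "F t * (\<sigma> * D t) \<ge> 0" for t
    using F(1) \<sigma> by (simp add: less_imp_le)
  moreover have "- \<sigma> * G (t + \<tau>) = - \<sigma> * G t" for t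
    unfolding G_def by (simp add: z_period v_period)
  ultimately have "F t1 * (\<sigma> * D t1) = 0"
    using \<tau> periodic_deriv_nonneg_imp_deriv_zero[where f = "\<lambda>t. - \<sigma> * G t"
        and f' = "\<lambda>t. F t * (\<sigma> * D t)"] by blast
  then show False using F(2) \<sigma>[of t1] by auto
qed

end
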